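(* Let $D\subset\mathbb{Z}^2$ and let $q:D\to\mathbb{R}^3$ be a discrete affine minimal map with discrete affine metric $F$ and discrete cubic form coefficients $A,B$. Then for every $(u,v)$ such that the four unit squares containing $(u,v)$ are contained in $D$, $$F(u-\tfrac12,v-\tfrac12)B_1(u+\tfrac12,v)-F(u+\tfrac12,v-\tfrac12)B_1(u-\tfrac12,v)=B(u,v)A_2(u,v-\tfrac12),$$ $$F(u-\tfrac12,v-\tfrac12)A_2(u,v+\tfrac12)-F(u-\tfrac12,v+\tfrac12)A_2(u,v-\tfrac12)=A(u,v)B_1(u-\tfrac12,v).$$
   Context: $[\cdot,\cdot,\cdot]$ is the determinant in $\mathbb{R}^3$. For a function $f$ on a subset of $\mathbb{Z}^2$: $f_1(u+\tfrac12,v)=f(u+1,v)-f(u,v)$, $f_2(u,v+\tfrac12)=f(u,v+1)-f(u,v)$, $f_{12}(u+\tfrac12,v+\tfrac12)=f(u+1,v+1)+f(u,v)-f(u+1,v)-f(u,v+1)$. The label $(u+\tfrac12,v+\tfrac12)$ denotes the unit square with lower-left vertex $(u,v)$. A discrete co-normal map is $\nu:D\to\mathbb{R}^3$ with $\nu_{12}=0$ and $F(u+\tfrac12,v+\tfrac12):=\nu(u,v)\cdot(\nu(u,v+1)\times\nu(u+1,v))>0$ on every unit square of $D$. A map $q:D\to\mathbb{R}^3$ is a discrete affine minimal map if there is a discrete co-normal map $\nu$ with $q_1(u+\tfrac12,v)=\nu(u,v)\times\nu(u+1,v)$ and $q_2(u,v+\tfrac12)=-\nu(u,v)\times\nu(u,v+1)$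 on all edges of $D$; the corresponding $F$ is its discrete affine metric. The affine normal is $\xi(u+\tfrac12,v+\tfrac12)=q_{12}(u+\tfrac12,v+\tfrac12)/F(u+\tfrac12,v+\tfrac12)$. The coefficients of the discrete cubic form are $$A(u,v)=[q_1(u-\tfrac12,v),q_1(u+\tfrac12,v),\xi(u\pm\tfrac12,v\pm\tfrac12)],\qquad B(u,v)=[q_2(u,v+\tfrac12),q_2(u,v-\tfrac12),\xi(u\pm\tfrac12,v\pm\tfrac12)],$$ where $\xi$ may be taken at any unit square of $D$ containing $(u,v)$ (the values do not depend on the choice). $A(u,v)$ is defined when $(u\pm1,v)\in D$ and $(u,v)$ lies in some unit square of $D$; $B(u,v)$ is defined when $(u,v\pm1)\in D$ and $(u,v)$ lies in some unit square of $D$. *)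

theory Defs
  imports "HOL-Analysis.Analysis"
begin

(* Half-integer labels are shifted down: the edge (u+1/2,v), the edge (u,v+1/2) and the unit
   square (u+1/2,v+1/2) all get the label (u,v).  So f_1(u-1/2,v) is diff1 f (u-1) v.
   Maps on a subset D of Z^2 are total functions int \<Rightarrow> int \<Rightarrow> 'a of which only the values on D
   (or on the edges and squares of D) are constrained. *)

definition diff1 :: "(int \<Rightarrow> int \<Rightarrow> 'a::ab_group_add) \<Rightarrow> int \<Rightarrow> int \<Rightarrow> 'a" where
  "diff1 f u v = f (u + 1) v - f u v"

definition diff2 :: "(int \<Rightarrow> int \<Rightarrow> 'a::ab_group_add) \<Rightarrow> int \<Rightarrow> int \<Rightarrow> 'a" where
  "diff2 f u v = f u (v + 1) - f u v"

definition diff12 :: "(int \<Rightarrow> int \<Rightarrow> 'a::ab_group_add) \<Rightarrow> int \<Rightarrow> int \<Rightarrow> 'a" where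
  "diff12 f u v = f (u + 1) (v + 1) + f u v - f (u + 1) v - f u (v + 1)"

definition unit_square :: "int \<Rightarrow> int \<Rightarrow> (int \<times> int) set" where
  "unit_square u v = {(u, v), (u + 1, v), (u, v + 1), (u + 1, v + 1)}"

definition det3 :: "real^3 \<Rightarrow> real^3 \<Rightarrow> real^3 \<Rightarrow> real" where
  "det3 a b c = det (vector [a, b, c] :: real^3^3)"

definition conormal_metric :: "(int \<Rightarrow> int \<Rightarrow> real^3) \<Rightarrow> int \<Rightarrow> int \<Rightarrow> real" where
  "conormal_metric \<nu> u v = \<nu> u v \<bullet> cross3 (\<nu> u (v + 1)) (\<nu> (u + 1) v)"

definition discrete_conormal_map ::
  "(int \<times> int) set \<Rightarrow> (int \<Rightarrow> int \<Rightarrow> real^3) \<Rightarrow> bool" where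
  "discrete_conormal_map D \<nu> \<longleftrightarrow>
     (\<forall>u v. unit_square u v \<subseteq> D \<longrightarrow> diff12 \<nu> u v = 0 \<and> conormal_metric \<nu> u v > 0)"

definition has_conormal_map ::
  "(int \<times> int) set \<Rightarrow> (int \<Rightarrow> int \<Rightarrow> real^3) \<Rightarrow> (int \<Rightarrow> int \<Rightarrow> real^3) \<Rightarrow> bool" where
  "has_conormal_map D q \<nu> \<longleftrightarrow>
     discrete_conormal_map D \<nu> \<and>
     (\<forall>u v. (u, v) \<in> D \<and> (u + 1, v) \<in> D \<longrightarrow> diff1 q u v = cross3 (\<nu> u v) (\<nu> (u + 1) v)) \<and>
     (\<forall>u v. (u, v) \<in> D \<and> (u, v + 1) \<in> D \<longrightarrow> diff2 q u v = - cross3 (\<nu> u v) (\<nu> u (v + 1)))"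

definition discrete_affine_minimal_map ::
  "(int \<times> int) set \<Rightarrow> (int \<Rightarrow> int \<Rightarrow> real^3) \<Rightarrow> bool" where
  "discrete_affine_minimal_map D q \<longleftrightarrow> (\<exists>\<nu>. has_conormal_map D q \<nu>)"

definition is_discrete_affine_metric ::
  "(int \<times> int) set \<Rightarrow> (int \<Rightarrow> int \<Rightarrow> real^3) \<Rightarrow> (int \<Rightarrow> int \<Rightarrow> real) \<Rightarrow> bool" where
  "is_discrete_affine_metric D q F \<longleftrightarrow>
     (\<exists>\<nu>. has_conormal_map D q \<nu> \<and>
        (\<forall>u v. unit_square u v \<subseteq> D \<longrightarrow> F u v = conormal_metric \<nu> u v))"

definition affine_normal ::
  "(int \<Rightarrow> int \<Rightarrow> real^3) \<Rightarrow> (int \<Rightarrow> int \<Rightarrow> real) \<Rightarrow> int \<Rightarrow> int \<Rightarrow> real^3" where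
  "affine_normal q F u v = diff12 q u v /\<^sub>R F u v"

(* The affine normal may be taken at any unit square (a, b) of D containing the vertex (u, v),
   possibly a different one for each vertex and for A and B; hence the existential
   quantifier.  At vertices where a coefficient is not defined, its value is unconstrained. *)

definition is_cubic_form_A ::
  "(int \<times> int) set \<Rightarrow> (int \<Rightarrow> int \<Rightarrow> real^3) \<Rightarrow> (int \<Rightarrow> int \<Rightarrow> real) \<Rightarrow> (int \<Rightarrow> int \<Rightarrow> real) \<Rightarrow> bool" where
  "is_cubic_form_A D q F A \<longleftrightarrow>
     (\<forall>u v. (u - 1, v) \<in> D \<and> (u + 1, v) \<in> D \<and>
            (\<exists>a b. (u, v) \<in> unit_square a b \<and> unit_square a b \<subseteq> D) \<longrightarrow>
        (\<exists>a b. (u, v) \<in> unit_square a b \<and> unit_square a b \<subseteq> D \<and>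
           A u v = det3 (diff1 q (u - 1) v) (diff1 q u v) (affine_normal q F a b)))"

definition is_cubic_form_B ::
  "(int \<times> int) set \<Rightarrow> (int \<Rightarrow> int \<Rightarrow> real^3) \<Rightarrow> (int \<Rightarrow> int \<Rightarrow> real) \<Rightarrow> (int \<Rightarrow> int \<Rightarrow> real) \<Rightarrow> bool" where
  "is_cubic_form_B D q F B \<longleftrightarrow>
     (\<forall>u v. (u, v - 1) \<in> D \<and> (u, v + 1) \<in> D \<and>
            (\<exists>a b. (u, v) \<in> unit_square a b \<and> unit_square a b \<subseteq> D) \<longrightarrow>
        (\<exists>a b. (u, v) \<in> unit_square a b \<and> unit_square a b \<subseteq> D \<and>
           B u v = det3 (diff2 q u v) (diff2 q u (v - 1)) (affine_normal q F a b)))"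

end

(* A conormal map pairs to 1 with the affine normal of every square at each vertex of that
   square.  Hence A and B do not depend on the chosen square and equal, up to sign,
   determinants of three consecutive conormals.  As the mixed difference of the conormals
   vanishes, on the 3x3 grid around (u, v) everything is a determinant in nu(u, v) and the four
   edge differences at (u, v), and both equations become three-term Pluecker relations. *)

theory Submission
  imports Defs
begin

lemma det3_eq_dot_cross: "det3 a b c = a \<bullet> cross3 b c"
  by (simp add: det3_def dot_cross_det)

lemma det3_coordinates:
  "det3 a b c = a$1 * (b$2 * c$3 - b$3 * c$2) + a$2 * (b$3 * c$1 - b$1 * c$3)
     + a$3 * (b$1 * c$2 - b$2 * c$1)"
  by (simp add: det3_eq_dot_cross cross3_def inner_vec_def sum_3)

text \<open>The cross product of \<open>cross3 a b\<close> and \<open>cross3 b c\<close> is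
  \<open>b\<close> scaled by \<open>det3 a b c\<close>.\<close>

lemma det3_cross_cross: "det3 (cross3 a b) (cross3 b c) x = det3 a b c * (b \<bullet> x)"
  by (simp add: det3_coordinates cross3_def inner_vec_def sum_3) algebra

lemma det3_swap_12: "det3 b a c = - det3 a b c"
  by (simp add: det3_coordinates algebra_simps)

lemma det3_minus_minus: "det3 (- a) (- b) c = det3 a b c"
  by (simp add: det3_coordinates algebra_simps)

text \<open>Every factor contains \<open>d\<close>, so modulo \<open>d\<close> this is the Pluecker
  relation for the 2x2 minors of four vectors \<open>n\<close>, \<open>l\<close>, \<open>r\<close>,
  \<open>t\<close> in a plane. The last factor is \<open>det3 d l r\<close> with its sign absorbed
  by a swap.\<close>

lemma det3_pluecker:
  "det3 d n l * det3 d r t - det3 d n r * det3 d l t = det3 d n t * det3 l d r"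
  unfolding det3_coordinates by algebra

lemma det3_differences: "det3 a m b = det3 (a - m) m (b - m)"
  by (simp add: det3_coordinates algebra_simps)

text \<open>Subtracting the middle row leaves \<open>det3 (a - n) m (b - n)\<close> and
  \<open>det3 (a - n) n (b - n)\<close>, which differ only in that row. This computes the change of
  \<open>A\<close> or \<open>B\<close> between neighbouring grid lines.\<close>

lemma det3_translate: "det3 (a + m - n) m (b + m - n) - det3 a n b = det3 (a - n) (m - n) (b - n)"
  by (simp add: det3_coordinates algebra_simps)

text \<open>Expanded, \<open>diff12 q a b\<close> is the sum of the cross products of
  \<open>n\<close>, \<open>y\<close>, \<open>x\<close> in cyclic order, a normal of the plane
  through these three points. Its inner product with each of them is \<open>det3 n y x\<close>, the
  metric, and the fourth conormal \<open>x + y - n\<close> is an affine combination of them.\<close>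

lemma conormal_dot_affine_normal:
  assumes q: "has_conormal_map D q \<nu>"
    and F: "\<And>a b. unit_square a b \<subseteq> D \<Longrightarrow> F a b = conormal_metric \<nu> a b"
    and sq: "unit_square a b \<subseteq> D" and uv: "(u, v) \<in> unit_square a b"
  shows "\<nu> u v \<bullet> affine_normal q F a b = 1"
proof -
  define n x y where "n = \<nu> a b" and "x = \<nu> (a + 1) b" and "y = \<nu> a (b + 1)"
  have D: "(a, b) \<in> D" "(a + 1, b) \<in> D" "(a, b + 1) \<in> D" "(a + 1, b + 1) \<in> D"
    using sq by (auto simp: unit_square_def)
  have "diff12 \<nu> a b = 0" and pos: "conormal_metric \<nu> a b > 0"
    using q sq by (auto simp: has_conormal_map_def discrete_conormal_map_def)
  then have z: "\<nu> (a + 1) (b + 1) = x + y - n"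
    by (simp add: diff12_def n_def x_def y_def algebra_simps)
  have "diff1 q a b = cross3 n x" "diff1 q a (b + 1) = cross3 y (x + y - n)"
    using q D z unfolding has_conormal_map_def n_def x_def y_def by metis+
  then have q12: "diff12 q a b = cross3 y (x + y - n) - cross3 n x"
    by (simp add: diff12_def diff1_def algebra_simps)
  have metric: "conormal_metric \<nu> a b = det3 n y x"
    by (simp add: conormal_metric_def det3_eq_dot_cross n_def x_def y_def)
  have "w \<bullet> diff12 q a b = det3 n y x" if "w \<in> {n, x, y, x + y - n}" for w
    using that unfolding q12
    by (elim insertE emptyE; hypsubst)
       (simp_all add: cross3_def det3_coordinates inner_vec_def sum_3 algebra_simps)
  moreover have "\<nu> u v \<in> {n, x, y, x + y - n}"
    using uv z by (auto simp: unit_square_def n_def x_def y_def)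
  ultimately show ?thesis
    using pos F[OF sq] by (simp add: affine_normal_def metric)
qed

text \<open>The two edges meeting at the vertex have a cross product parallel to
  \<open>\<nu> u v\<close>, which pairs to 1 with the affine normal of whichever square was
  chosen.\<close>

lemma cubic_form_A_eq:
  assumes q: "has_conormal_map D q \<nu>"
    and F: "\<And>a b. unit_square a b \<subseteq> D \<Longrightarrow> F a b = conormal_metric \<nu> a b"
    and A: "is_cubic_form_A D q F A"
    and D: "(u - 1, v) \<in> D" "(u + 1, v) \<in> D"
    and sq: "(u, v) \<in> unit_square a b" "unit_square a b \<subseteq> D"
  shows "A u v = det3 (\<nu> (u - 1) v) (\<nu> u v) (\<nu> (u + 1) v)"
proof -
  obtain c d where cd: "(u, v) \<in> unit_square c d" "unit_square c d \<subseteq> D"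
    and eq: "A u v = det3 (diff1 q (u - 1) v) (diff1 q u v) (affine_normal q F c d)"
    using A D sq unfolding is_cubic_form_A_def by metis
  have "(u, v) \<in> D"
    using sq by blast
  then have "diff1 q (u - 1) v = cross3 (\<nu> (u - 1) v) (\<nu> u v)"
    "diff1 q u v = cross3 (\<nu> u v) (\<nu> (u + 1) v)"
    using q D by (auto simp: has_conormal_map_def dest!: spec[of _ "u - 1"])
  then show ?thesis
    by (simp add: eq det3_cross_cross conormal_dot_affine_normal[OF q F cd(2,1)])
qed

lemma cubic_form_B_eq:
  assumes q: "has_conormal_map D q \<nu>"
    and F: "\<And>a b. unit_square a b \<subseteq> D \<Longrightarrow> F a b = conormal_metric \<nu> a b"
    and B: "is_cubic_form_B D q F B"
    and D: "(u, v - 1) \<in> D" "(u, v + 1) \<in> D"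
    and sq: "(u, v) \<in> unit_square a b" "unit_square a b \<subseteq> D"
  shows "B u v = - det3 (\<nu> u (v - 1)) (\<nu> u v) (\<nu> u (v + 1))"
proof -
  obtain c d where cd: "(u, v) \<in> unit_square c d" "unit_square c d \<subseteq> D"
    and eq: "B u v = det3 (diff2 q u v) (diff2 q u (v - 1)) (affine_normal q F c d)"
    using B D sq unfolding is_cubic_form_B_def by metis
  have uv: "(u, v) \<in> D"
    using sq by blast
  have q2: "diff2 q a b = - cross3 (\<nu> a b) (\<nu> a (b + 1))"
    if "(a, b) \<in> D" "(a, b + 1) \<in> D" for a b
    using q that by (simp add: has_conormal_map_def)
  have "diff2 q u (v - 1) = - cross3 (\<nu> u (v - 1)) (\<nu> u v)"
    "diff2 q u v = - cross3 (\<nu> u v) (\<nu> u (v + 1))"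
    using q2[of u "v - 1"] q2[of u v] D uv by simp_all
  \<comment> \<open>The minus signs of the two edges cancel. The sign that remains comes from the
    order in \<open>B\<close>, where the forward edge stands first.\<close>
  then have "B u v = - det3 (cross3 (\<nu> u (v - 1)) (\<nu> u v)) (cross3 (\<nu> u v) (\<nu> u (v + 1)))
      (affine_normal q F c d)"
    by (simp add: eq det3_minus_minus det3_swap_12[of "cross3 (\<nu> u v) (\<nu> u (v + 1))"])
  then show ?thesis
    by (simp add: det3_cross_cross conormal_dot_affine_normal[OF q F cd(2,1)])
qed

theorem mainTheorem5:
  fixes D :: "(int \<times> int) set"
    and q :: "int \<Rightarrow> int \<Rightarrow> real^3"
    and F A B :: "int \<Rightarrow> int \<Rightarrow> real"
    and u v :: int
  assumes "discrete_affine_minimal_map D q"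
    and "is_discrete_affine_metric D q F"
    and "is_cubic_form_A D q F A"
    and "is_cubic_form_B D q F B"
    and "\<forall>a b. (u, v) \<in> unit_square a b \<longrightarrow> unit_square a b \<subseteq> D"
  shows "F (u - 1) (v - 1) * diff1 B u v - F u (v - 1) * diff1 B (u - 1) v
           = B u v * diff2 A u (v - 1) \<and>
         F (u - 1) (v - 1) * diff2 A u v - F (u - 1) v * diff2 A u (v - 1)
           = A u v * diff1 B (u - 1) v"
proof -
  obtain \<nu> where q: "has_conormal_map D q \<nu>"
    and F: "\<And>a b. unit_square a b \<subseteq> D \<Longrightarrow> F a b = conormal_metric \<nu> a b"
    using assms(2) by (auto simp: is_discrete_affine_metric_def)
  have sq: "unit_square u v \<subseteq> D" "unit_square (u - 1) v \<subseteq> D"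
    "unit_square u (v - 1) \<subseteq> D" "unit_square (u - 1) (v - 1) \<subseteq> D"
    using assms(5) by (simp_all add: unit_square_def)
  then have D: "(a, b) \<in> D" if "a \<in> {u - 1, u, u + 1}" "b \<in> {v - 1, v, v + 1}" for a b
    using that by (auto simp: unit_square_def)
  have flat: "diff12 \<nu> a b = 0" if "unit_square a b \<subseteq> D" for a b
    using q that by (auto simp: has_conormal_map_def discrete_conormal_map_def)
  define n l r d t where "n = \<nu> u v" and "l = \<nu> (u - 1) v" and "r = \<nu> (u + 1) v"
    and "d = \<nu> u (v - 1)" and "t = \<nu> u (v + 1)"
  note edge = n_def[symmetric] l_def[symmetric] r_def[symmetric] d_def[symmetric] t_def[symmetric]
  have corner: "\<nu> (u + 1) (v + 1) = r + t - n" "\<nu> (u - 1) (v + 1) = l + t - n"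
    "\<nu> (u + 1) (v - 1) = r + d - n" "\<nu> (u - 1) (v - 1) = l + d - n"
    using sq[THEN flat] by (simp_all add: diff12_def edge) (simp_all add: algebra_simps)
  have A: "A u b = det3 (\<nu> (u - 1) b) (\<nu> u b) (\<nu> (u + 1) b)" if "b \<in> {v - 1, v, v + 1}" for b
  proof -
    \<comment> \<open>The formula for \<open>A\<close> needs a square of \<open>D\<close> at each
      vertex; these two cover the middle column of the grid.\<close>
    have "(u, b) \<in> unit_square u v \<or> (u, b) \<in> unit_square u (v - 1)"
      using that by (auto simp: unit_square_def)
    then show ?thesis
      using cubic_form_A_eq[OF q F assms(3)] D that sq by blast
  qed
  have B: "B a v = - det3 (\<nu> a (v - 1)) (\<nu> a v) (\<nu> a (v + 1))" if "a \<in> {u - 1, u, u + 1}" for a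
  proof -
    have "(a, v) \<in> unit_square u v \<or> (a, v) \<in> unit_square (u - 1) v"
      using that by (auto simp: unit_square_def)
    then show ?thesis
      using cubic_form_B_eq[OF q F assms(4)] D that sq by blast
  qed
  define l' r' d' t' where "l' = l - n" and "r' = r - n" and "d' = d - n" and "t' = t - n"
  note difference = l'_def r'_def d'_def t'_def
  \<comment> \<open>Row operations bring each square's determinant to the central conormal
    \<open>n\<close> and the two edge differences bounding that square at the centre.\<close>
  have metric: "F (u - 1) (v - 1) = det3 l' n d'" "F u (v - 1) = det3 d' n r'"
    "F (u - 1) v = det3 t' n l'"
    by (simp_all add: F sq conormal_metric_def det3_eq_dot_cross[symmetric] edge corner difference)
       (simp_all add: det3_coordinates algebra_simps)
  have AB: "A u v = det3 l' n r'" "B u v = - det3 d' n t'"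
    using det3_differences[of l n r] det3_differences[of d n t]
    by (simp_all add: A B edge difference)
  have A2: "diff2 A u v = det3 l' t' r'" "diff2 A u (v - 1) = - det3 l' d' r'"
    using det3_translate[of l t n r] det3_translate[of l d n r]
    by (simp_all add: diff2_def A edge corner difference)
  \<comment> \<open>The outer columns are the central one translated by \<open>r'\<close> and
    \<open>l'\<close>. The sums in \<open>corner\<close> are commuted to match
    \<open>det3_translate\<close>.\<close>
  have B1: "diff1 B u v = - det3 d' r' t'" "diff1 B (u - 1) v = det3 d' l' t'"
    using det3_translate[of d r n t] det3_translate[of d l n t]
    by (simp_all add: diff1_def B edge corner difference
        add.commute[of d r] add.commute[of t r] add.commute[of d l] add.commute[of t l])
  have swap: "det3 d' n l' = - det3 l' n d'" "det3 t' n l' = - det3 l' n t'"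
    by (simp_all add: det3_coordinates algebra_simps)
  \<comment> \<open>The first equation is the relation with common vector \<open>d'\<close>, the
    second the one with common vector \<open>l'\<close>.\<close>
  show ?thesis
    using det3_pluecker[of d' n l' r' t'] det3_pluecker[of l' n d' t' r']
    by (simp add: metric AB A2 B1 swap det3_swap_12[of d' l'] algebra_simps)
qed

end
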